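(* Let $l\geqslant 1$ and $n\geqslant l+2$ be integers. Then $\kappa_l(n,2)=\left\lfloor\dfrac{n+l}{2}\right\rfloor$.
   Context: For a positive integer $n$, $[n]=\{1,\ldots,n\}$. A family $\mathcal{F}$ of subsets of $[n]$ is an $m$-family if it has $m$ members (required to be pairwise distinct subsets); it is $k$-uniform if every member has size $k$; for a set $L$ of nonnegative integers it is $L$-intersecting if $|F\cap F'|\in L$ for every two distinct members $F,F'$. $\kappa_{L}(n,m)$ denotes the maximum $k$ such that there exists a $k$-uniform $L$-intersecting $m$-family of subsets of $[n]$ (and $-\infty$ if none exists), and $\kappa_l(n,m)$ denotes $\kappa_{\{l\}}(n,m)$. *)

theory Defs
  imports "HOL-Library.Extended_Real"
begin

(* A family is a set of sets, so its members are automatically pairwise distinct. *)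
definition family_on :: "nat \<Rightarrow> nat \<Rightarrow> nat set set \<Rightarrow> bool" where
  "family_on n m \<F> \<longleftrightarrow> \<F> \<subseteq> Pow {1..n} \<and> card \<F> = m"

definition uniform :: "nat \<Rightarrow> nat set set \<Rightarrow> bool" where
  "uniform k \<F> \<longleftrightarrow> (\<forall>F\<in>\<F>. card F = k)"

definition intersecting :: "nat set \<Rightarrow> nat set set \<Rightarrow> bool" where
  "intersecting L \<F> \<longleftrightarrow> (\<forall>F\<in>\<F>. \<forall>F'\<in>\<F>. F \<noteq> F' \<longrightarrow> card (F \<inter> F') \<in> L)"

definition kappa_sizes :: "nat set \<Rightarrow> nat \<Rightarrow> nat \<Rightarrow> nat set" where
  "kappa_sizes L n m = {k. \<exists>\<F>. family_on n m \<F> \<and> uniform k \<F> \<and> intersecting L \<F>}"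

(* The values are extended reals because of the convention -\<infinity> when no family exists.
   For m > 0 the set of sizes is finite (see below), so Max is its actual maximum;
   for m = 0 the empty family is k-uniform for every k, no maximum exists, and the
   value of kappa is unspecified. *)
definition kappa :: "nat set \<Rightarrow> nat \<Rightarrow> nat \<Rightarrow> ereal" where
  "kappa L n m =
     (if kappa_sizes L n m = {} then -\<infinity> else ereal (real (Max (kappa_sizes L n m))))"

lemma finite_kappa_sizes:
  assumes "m > 0"
  shows "finite (kappa_sizes L n m)"
proof (rule finite_subset)
  show "kappa_sizes L n m \<subseteq> {..n}"
  proof
    fix k assume "k \<in> kappa_sizes L n m"
    then obtain \<F> where F: "\<F> \<subseteq> Pow {1..n}" "card \<F> = m" "\<forall>F\<in>\<F>. card F = k"
      unfolding kappa_sizes_def family_on_def uniform_def by blast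
    with assms obtain F where "F \<in> \<F>" by fastforce
    with F have "F \<subseteq> {1..n}" "card F = k" by auto
    then show "k \<in> {..n}" using card_mono[of "{1..n}" F] by simp
  qed
qed simp

end

theory Submission
  imports Defs
begin

text \<open>By inclusion-exclusion, two \<open>k\<close>-sets meeting in \<open>l\<close> points
  have a union of size 2k - l. This must fit into [n], so k \<le> (n + l)/2
  (\<open>kappa_sizes_pair_le\<close>). Conversely, if l < k and 2k - l \<le> n, there is room in
  [n] for two distinct such sets (\<open>kappa_sizes_pairI\<close>), so the bound is attained at its
  integer part.\<close>

lemma kappa_sizes_pair_le:
  assumes "k \<in> kappa_sizes {l} n 2"
  shows "k \<le> (n + l) div 2"
proof -
  obtain A B where AB: "A \<noteq> B" "A \<subseteq> {1..n}" "B \<subseteq> {1..n}"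
    and k: "card A = k" "card B = k" "card (A \<inter> B) = l"
  proof -
    obtain \<F> where F: "\<F> \<subseteq> Pow {1..n}" "card \<F> = 2" "uniform k \<F>" "intersecting {l} \<F>"
      using assms unfolding kappa_sizes_def family_on_def by blast
    then obtain A B where "\<F> = {A, B}" "A \<noteq> B"
      unfolding card_2_iff by blast
    with F that show thesis
      unfolding uniform_def intersecting_def by simp
  qed
  have fin: "finite A" "finite B"
    using AB finite_subset by blast+
  have "card (A \<union> B) \<le> n"
    using card_mono[of "{1..n}" "A \<union> B"] AB by simp
  with card_Un_Int[OF fin] k show ?thesis
    by simp
qed

lemma kappa_sizes_pairI:
  assumes "l < k" and "2 * k \<le> n + l"
  shows "k \<in> kappa_sizes {l} n 2"
proof -
  define A where "A = {1..k}"
  \<comment> \<open>The common core {1..l} is completed by the k - l points just after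
    \<open>A\<close>, so the union is exactly {1..2k - l}.\<close>
  define B where "B = {1..l} \<union> {k + 1..2 * k - l}"
  have "A \<inter> B = {1..l}"
    using assms(1) by (auto simp: A_def B_def)
  then have int: "card (A \<inter> B) = l"
    by simp
  have "card B = card {1..l} + card {k + 1..2 * k - l}"
    unfolding B_def using assms(1) by (intro card_Un_disjoint) auto
  then have card: "card A = k" "card B = k"
    using assms(1) by (simp_all add: A_def)
  \<comment> \<open>If the sets were equal, their intersection would have \<open>k\<close> >
    \<open>l\<close> points.\<close>
  with int assms(1) have ne: "A \<noteq> B"
    by auto
  have sub: "A \<subseteq> {1..n}" "B \<subseteq> {1..n}"
    using assms by (auto simp: A_def B_def)
  have "family_on n 2 {A, B}" "uniform k {A, B}" "intersecting {l} {A, B}"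
    using int card ne sub
    by (simp_all add: family_on_def uniform_def intersecting_def Int_commute)
  then show ?thesis
    unfolding kappa_sizes_def by blast
qed

theorem theorem2p2:
  fixes l n :: nat
  assumes "l \<ge> 1" and "n \<ge> l + 2"
  shows "kappa {l} n 2 = ereal (real_of_int \<lfloor>(real n + real l) / 2\<rfloor>)"
proof -
  \<comment> \<open>Since n + l \<ge> 2l + 2, the half is at least l + 1, which gives the strict
    inequality needed for two distinct sets.\<close>
  have mem: "(n + l) div 2 \<in> kappa_sizes {l} n 2"
    using assms by (intro kappa_sizes_pairI) auto
  have "Max (kappa_sizes {l} n 2) = (n + l) div 2"
    using mem kappa_sizes_pair_le by (intro Max_eqI finite_kappa_sizes) auto
  moreover have "\<lfloor>(real n + real l) / 2\<rfloor> = int ((n + l) div 2)"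
    using floor_divide_of_nat_eq[of "n + l" 2, where 'a = real] by simp
  ultimately show ?thesis
    using mem by (auto simp: kappa_def)
qed

end
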